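(* Let $G=(V,E)$ be a graph, let $U\subseteq V$ be a non-empty set, and let $v\notin V$ be a new vertex. For each $W\subseteq U$ define $$A_W=\begin{cases}x^{|W|} & \text{if } \bigcap_{w\in W}N_G(w)=\emptyset,\\ 0 & \text{otherwise.}\end{cases}$$ Then $$N(G_{U\rhd v},x)=N(G,x)+\sum_{\substack{W\subseteq U\\ W\neq\emptyset}}(-1)^{|W|+1}x(1+x)^{|\bigcap_{w\in W}N_G(w)|}+\sum_{\substack{W\subseteq U\\ W\neq\emptyset}}A_W.$$
   Context: All graphs are simple, finite and undirected. For a graph $G=(V,E)$ and $v\in V$, $N_G(v)=\{u\in V: \{u,v\}\in E\}$ is the open neighborhood of $v$. The neighborhood complex of $G$ is $\mathcal N(G)=\{A\subseteq V : \exists v\in V,\ A\subseteq N_G(v)\}$, and the neighborhood polynomial of $G$ is $N(G,x)=\sum_{A\in\mathcal N(G)}x^{|A|}$. For $U\subseteq V$ and a new vertex $v\notin V$, $G_{U\rhd v}=(V\cup\{v\},E\cup\{\{u,v\}: u\in U\})$ is the graph obtained from $G$ by adding $v$ and joining it to all vertices of $U$. *)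

theory Defs
  imports Main "HOL-Computational_Algebra.Polynomial"
begin

text \<open>A graph is a pair of a vertex set and a set of edges, the edges being two-element sets of
  vertices; being simple, finite and undirected is the predicate \<open>simple_graph\<close>.\<close>

type_synonym 'a graph = "'a set \<times> 'a set set"

abbreviation verts :: "'a graph \<Rightarrow> 'a set" where
  "verts G \<equiv> fst G"

abbreviation edges :: "'a graph \<Rightarrow> 'a set set" where
  "edges G \<equiv> snd G"

definition simple_graph :: "'a graph \<Rightarrow> bool" where
  "simple_graph G \<longleftrightarrow> finite (verts G) \<and> (\<forall>e\<in>edges G. e \<subseteq> verts G \<and> card e = 2)"

definition nbhd :: "'a graph \<Rightarrow> 'a \<Rightarrow> 'a set" where
  "nbhd G v = {u \<in> verts G. {u, v} \<in> edges G}"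

definition nbhd_complex :: "'a graph \<Rightarrow> 'a set set" where
  "nbhd_complex G = {A. A \<subseteq> verts G \<and> (\<exists>v\<in>verts G. A \<subseteq> nbhd G v)}"

abbreviation X :: "int poly" where
  "X \<equiv> [:0, 1:]"

definition nbhd_poly :: "'a graph \<Rightarrow> int poly" where
  "nbhd_poly G = (\<Sum>A\<in>nbhd_complex G. X ^ card A)"

definition add_vertex :: "'a graph \<Rightarrow> 'a set \<Rightarrow> 'a \<Rightarrow> 'a graph" where
  "add_vertex G U v = (verts G \<union> {v}, edges G \<union> {{u, v} |u. u \<in> U})"

lemma simple_graph_add_vertex:
  assumes "simple_graph G" "U \<subseteq> verts G" "v \<notin> verts G"
  shows "simple_graph (add_vertex G U v)"
proof -
  have "card {u, v} = 2" if "u \<in> U" for u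
    using assms that by (auto simp: card_insert_if)
  then show ?thesis
    using assms by (auto simp: simple_graph_def add_vertex_def)
qed

text \<open>The intersection over the empty family is \<open>UNIV\<close>, not the vertex set, so \<open>W\<close> is meant to
  be non-empty here.\<close>

definition A_term :: "'a graph \<Rightarrow> 'a set \<Rightarrow> int poly" where
  "A_term G W = (if (\<Inter>w\<in>W. nbhd G w) = {} then X ^ card W else 0)"

end

theory Submission
  imports Defs
begin

text \<open>The faces of the new complex are of three kinds: the faces of the old one, the subsets of
  \<open>U = N(v)\<close>, and the sets \<open>insert v A\<close> where \<open>A \<subseteq> N(w)\<close> for some \<open>w \<in> U\<close>. The third kind is
  counted by inclusion-exclusion over the simplices on \<open>N(w)\<close>, \<open>w \<in> U\<close>. A non-empty \<open>W \<subseteq> U\<close> is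
  an old face iff it has a common neighbour in \<open>G\<close>, which yields the terms \<open>A\<^sub>W\<close>.\<close>

text \<open>Expand the product of \<open>card S\<close> factors \<open>x + 1\<close>: a subset
  \<open>A\<close> records the factors from which \<open>x\<close> is taken.\<close>

lemma sum_Pow_power_card:
  fixes x :: "'b::comm_ring_1"
  assumes "finite S"
  shows "(\<Sum>A\<in>Pow S. x ^ card A) = (1 + x) ^ card S"
  using prod_add[OF assms, of "\<lambda>_. x" "\<lambda>_. 1"] by (simp add: add.commute)

text \<open>The weight of a finite family of sets is additive over disjoint unions, so
  inclusion-exclusion applies to it. Full simplices intersect in the full simplex on the common
  vertices, whose weight is a power of \<open>1 + x\<close>.\<close>

lemma inclusion_exclusion_simplices:
  fixes x :: "'b::comm_ring_1"
  assumes fin: "finite U" "\<And>u. u \<in> U \<Longrightarrow> finite (F u)"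
  shows "(\<Sum>A\<in>(\<Union>u\<in>U. Pow (F u)). x ^ card A)
    = (\<Sum>W | W \<subseteq> U \<and> W \<noteq> {}. (-1) ^ (card W + 1) * (1 + x) ^ card (\<Inter>w\<in>W. F w))"
proof -
  interpret Incl_Excl finite "\<lambda>K. \<Sum>A\<in>K. x ^ card A"
    by unfold_locales (auto simp: sum.union_disjoint disjnt_def)
  have "(\<Sum>A\<in>(\<Union>u\<in>U. Pow (F u)). x ^ card A)
      = (\<Sum>W | W \<subseteq> U \<and> W \<noteq> {}. (-1) ^ (card W + 1) * (\<Sum>A\<in>(\<Inter>w\<in>W. Pow (F w)). x ^ card A))"
    using fin by (intro restricted_indexed) auto
  also have "\<dots> = (\<Sum>W | W \<subseteq> U \<and> W \<noteq> {}. (-1) ^ (card W + 1) * (1 + x) ^ card (\<Inter>w\<in>W. F w))"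
  proof (rule sum.cong[OF refl])
    fix W assume W: "W \<in> {W. W \<subseteq> U \<and> W \<noteq> {}}"
    \<comment> \<open>A member of \<open>W\<close> bounds the intersection by the finite set
      \<open>F w\<close>; over an empty \<open>W\<close> it would be \<open>UNIV\<close>.\<close>
    then obtain w where "w \<in> W" "w \<in> U" by auto
    then have "finite (\<Inter>w\<in>W. F w)"
      using fin by (meson INF_lower finite_subset)
    moreover have "(\<Inter>w\<in>W. Pow (F w)) = Pow (\<Inter>w\<in>W. F w)"
      by auto
    ultimately show "(-1) ^ (card W + 1) * (\<Sum>A\<in>(\<Inter>w\<in>W. Pow (F w)). x ^ card A)
        = (-1) ^ (card W + 1) * (1 + x) ^ card (\<Inter>w\<in>W. F w)"
      by (simp only: sum_Pow_power_card)
  qed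
  finally show ?thesis .
qed

lemma nbhd_add_vertex:
  assumes "simple_graph G" "U \<subseteq> verts G" "v \<notin> verts G"
  shows "nbhd (add_vertex G U v) v = U"
    and "w \<in> U \<Longrightarrow> nbhd (add_vertex G U v) w = insert v (nbhd G w)"
    and "w \<in> verts G - U \<Longrightarrow> nbhd (add_vertex G U v) w = nbhd G w"
proof -
  \<comment> \<open>Old edges lie inside \<open>verts G\<close>, so every edge at \<open>v\<close>
    is a new one.\<close>
  have v: "{u, v} \<notin> edges G" "{v, u} \<notin> edges G" for u
    using assms by (auto simp: simple_graph_def)
  show "nbhd (add_vertex G U v) v = U"
    using assms v by (auto simp: nbhd_def add_vertex_def doubleton_eq_iff)
  show "nbhd (add_vertex G U v) w = insert v (nbhd G w)" if "w \<in> U"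
    using that assms v by (auto simp: nbhd_def add_vertex_def doubleton_eq_iff)
  show "nbhd (add_vertex G U v) w = nbhd G w" if "w \<in> verts G - U"
    using that assms v by (auto simp: nbhd_def add_vertex_def doubleton_eq_iff)
qed

lemma nbhd_subset: "nbhd G w \<subseteq> verts G"
  by (auto simp: nbhd_def)

lemma nbhd_complex_eq: "nbhd_complex G = (\<Union>w\<in>verts G. Pow (nbhd G w))"
  unfolding nbhd_complex_def using nbhd_subset[of G] by blast

text \<open>Removing the old faces from \<open>Pow U\<close> makes the three pieces disjoint, so
  that a sum over the new complex splits into three sums.\<close>

lemma nbhd_complex_add_vertex:
  assumes "simple_graph G" "U \<subseteq> verts G" "v \<notin> verts G"
  shows "nbhd_complex (add_vertex G U v)
    = nbhd_complex G \<union> (Pow U - nbhd_complex G) \<union> insert v ` (\<Union>w\<in>U. Pow (nbhd G w))"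
proof -
  let ?H = "add_vertex G U v"
  have "verts ?H = insert v (U \<union> (verts G - U))"
    using assms by (auto simp: add_vertex_def)
  then have "nbhd_complex ?H
      = Pow U \<union> (\<Union>w\<in>U. Pow (insert v (nbhd G w))) \<union> (\<Union>w\<in>verts G - U. Pow (nbhd G w))"
    by (simp add: nbhd_complex_eq nbhd_add_vertex[OF assms] Un_assoc del: Un_Diff_cancel)
  also have "\<dots> = Pow U \<union> nbhd_complex G \<union> insert v ` (\<Union>w\<in>U. Pow (nbhd G w))"
  proof -
    \<comment> \<open>Split the faces by whether they contain \<open>v\<close>; those without it
      rejoin the simplices at vertices outside \<open>U\<close> to form the old complex.\<close>
    have "(\<Union>w\<in>U. Pow (insert v (nbhd G w)))
        = (\<Union>w\<in>U. Pow (nbhd G w)) \<union> insert v ` (\<Union>w\<in>U. Pow (nbhd G w))"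
      by (simp only: Pow_insert UN_Un_distrib image_UN)
    moreover have "nbhd_complex G = (\<Union>w\<in>U. Pow (nbhd G w)) \<union> (\<Union>w\<in>verts G - U. Pow (nbhd G w))"
      unfolding nbhd_complex_eq using assms(2) by blast
    ultimately show ?thesis by (simp only: Un_ac)
  qed
  finally show ?thesis
    by (simp only: Un_Diff_cancel Un_commute[of "Pow U"])
qed

text \<open>Adjacency is symmetric: \<open>W\<close> lies in the neighbourhood of \<open>u\<close>
  exactly when \<open>u\<close> is a common neighbour of all members of \<open>W\<close>.\<close>

lemma mem_nbhd_complex_iff:
  assumes "W \<subseteq> verts G" "W \<noteq> {}"
  shows "W \<in> nbhd_complex G \<longleftrightarrow> (\<Inter>w\<in>W. nbhd G w) \<noteq> {}"
proof -
  have sym: "u \<in> nbhd G w \<longleftrightarrow> w \<in> nbhd G u" if "u \<in> verts G" "w \<in> verts G" for u w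
    using that by (simp add: nbhd_def insert_commute)
  have "W \<in> nbhd_complex G \<longleftrightarrow> (\<exists>u\<in>verts G. \<forall>w\<in>W. w \<in> nbhd G u)"
    using assms by (auto simp: nbhd_complex_def)
  also have "\<dots> \<longleftrightarrow> (\<exists>u\<in>verts G. \<forall>w\<in>W. u \<in> nbhd G w)"
    using sym assms by (meson subsetD)
  also have "\<dots> \<longleftrightarrow> (\<Inter>w\<in>W. nbhd G w) \<noteq> {}"
  proof -
    \<comment> \<open>Any point of the intersection lies in \<open>nbhd G w\<close> and so is a
      vertex, as the left side requires.\<close>
    obtain w where "w \<in> W" using assms(2) by blast
    then show ?thesis using nbhd_subset[of G w] by blast
  qed
  finally show ?thesis .
qed

theorem theorem9:
  fixes G :: "'a graph" and U :: "'a set" and v :: 'a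
  assumes "simple_graph G"
    and "U \<subseteq> verts G" and "U \<noteq> {}"
    and "v \<notin> verts G"
  shows "nbhd_poly (add_vertex G U v) =
      nbhd_poly G
      + (\<Sum>W | W \<subseteq> U \<and> W \<noteq> {}.
           (-1) ^ (card W + 1) * X * (1 + X) ^ card (\<Inter>w\<in>W. nbhd G w))
      + (\<Sum>W | W \<subseteq> U \<and> W \<noteq> {}. A_term G W)"
proof -
  let ?L = "\<Union>w\<in>U. Pow (nbhd G w)" and ?P = "{W. W \<subseteq> U \<and> W \<noteq> {}}"
  have finV: "finite (verts G)"
    using assms by (simp add: simple_graph_def)
  have finU: "finite U"
    by (rule finite_subset[OF assms(2) finV])
  have finN: "finite (nbhd G w)" for w
    by (rule finite_subset[OF nbhd_subset finV])
  have finL: "finite ?L" and finP: "finite ?P" and finK: "finite (nbhd_complex G)"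
    using finU finN finV by (simp_all add: nbhd_complex_eq)
  \<comment> \<open>This one fact makes \<open>insert v\<close> injective on \<open>?L\<close>,
    makes it raise cardinality by one (the factor \<open>X\<close>), and separates its image from
    the other faces.\<close>
  have noK: "v \<notin> A" if "A \<in> nbhd_complex G \<or> A \<in> ?L \<or> A \<subseteq> U" for A
    using that assms(2,4) nbhd_subset[of G] by (fastforce simp: nbhd_complex_eq)
  have finA: "finite A" if "A \<in> ?L" for A
    using that finite_subset[OF _ finN] by blast

  have "inj_on (insert v) ?L"
  proof (rule inj_onI)
    fix A B assume "A \<in> ?L" "B \<in> ?L" "insert v A = insert v B"
    then show "A = B"
      using noK[of A] noK[of B] by (simp only: insert_ident simp_thms)
  qed
  then have "(\<Sum>A\<in>insert v ` ?L. X ^ card A) = (\<Sum>A\<in>?L. X ^ card (insert v A))"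
    by (simp only: sum.reindex o_def)
  also have "\<dots> = X * (\<Sum>A\<in>?L. X ^ card A)"
    unfolding sum_distrib_left
  proof (rule sum.cong[OF refl])
    fix A assume "A \<in> ?L"
    then have "card (insert v A) = Suc (card A)"
      using noK[of A] finA[of A] by (simp only: card_insert_disjoint simp_thms)
    then show "X ^ card (insert v A) = X * X ^ card A"
      by (simp only: power_Suc)
  qed
  also have "\<dots> = (\<Sum>W\<in>?P. (-1) ^ (card W + 1) * X * (1 + X) ^ card (\<Inter>w\<in>W. nbhd G w))"
    unfolding inclusion_exclusion_simplices[OF finU finN] sum_distrib_left
    by (simp only: mult_ac)
  finally have new: "(\<Sum>A\<in>insert v ` ?L. X ^ card A) = \<dots>" .

  \<comment> \<open>Since \<open>U\<close> is non-empty, \<open>G\<close> has a vertex, so the empty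
    set is an old face and every missing subset of \<open>U\<close> is non-empty.\<close>
  have "{} \<in> nbhd_complex G"
    using assms(2,3) by (auto simp: nbhd_complex_eq)
  then have "Pow U - nbhd_complex G = {W \<in> ?P. W \<notin> nbhd_complex G}"
    by blast
  also have "\<dots> = {W \<in> ?P. (\<Inter>w\<in>W. nbhd G w) = {}}"
  proof (rule Collect_cong)
    show "W \<in> ?P \<and> W \<notin> nbhd_complex G \<longleftrightarrow> W \<in> ?P \<and> (\<Inter>w\<in>W. nbhd G w) = {}" for W
      using mem_nbhd_complex_iff[of W G] assms(2) by auto
  qed
  finally have "Pow U - nbhd_complex G = {W \<in> ?P. (\<Inter>w\<in>W. nbhd G w) = {}}" .
  \<comment> \<open>The default value 0 of \<open>A_term\<close> lets the sum run over all of
    \<open>?P\<close>.\<close>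
  then have miss: "(\<Sum>A\<in>Pow U - nbhd_complex G. X ^ card A) = (\<Sum>W\<in>?P. A_term G W)"
    using finP by (simp only: A_term_def sum.inter_filter)

  have "nbhd_poly (add_vertex G U v) = nbhd_poly G
      + (\<Sum>A\<in>Pow U - nbhd_complex G. X ^ card A) + (\<Sum>A\<in>insert v ` ?L. X ^ card A)"
    unfolding nbhd_poly_def nbhd_complex_add_vertex[OF assms(1,2,4)]
  proof (subst sum.union_disjoint)
    show "(nbhd_complex G \<union> (Pow U - nbhd_complex G)) \<inter> insert v ` ?L = {}"
      using noK by blast
  qed (use finU finL finK in \<open>simp_all add: sum.union_disjoint del: Un_Diff_cancel\<close>)
  then show ?thesis
    unfolding new miss by (simp only: add_ac)
qed

end
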